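(* Let $P_n$ denote the path on $n$ vertices. For every $n \ge 1$, $$\iota_{\rm g}(P_n)=\begin{cases}\left\lfloor\frac{2n+1}{5}\right\rfloor-1, & \text{if } n\equiv 0 \pmod 5,\\[2pt] \left\lfloor\frac{2n+1}{5}\right\rfloor, & \text{otherwise},\end{cases}$$ and $$\iota_{\rm g}'(P_n)=\left\lfloor\frac{2n+2}{5}\right\rfloor.$$
   Context: For a graph $G$ and $X\subseteq V(G)$, $N_G[X]$ denotes the set of vertices in $X$ or adjacent to a vertex of $X$. The isolation game on a finite graph $G$ is played by two players, Dominator and Staller, who alternately select vertices of $G$. If $X$ is the set of vertices selected so far, a vertex $x$ may be selected (is playable) only if $x$ dominates (i.e., equals or is adjacent to) some vertex belonging to a component of $G - N_G[X]$ with at least two vertices. The game ends when no playable vertex exists. Dominator aims to minimize the total number of selected vertices, Staller aims to maximize it. The game isolation number $\iota_{\rm g}(G)$ is the number of vertices selected when Dominator makes the first move and both play optimally; $\iota_{\rm g}'(G)$ is the same quantity when Staller makes the first move. *)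

theory Defs
  imports Complex_Main "Graph_Theory.Graph_Theory"
begin

text \<open>
  A finite simple graph is a symmetric loop-free digraph with finitely many vertices, i.e. an
  instance of \<^locale>\<open>pair_graph\<close>: an edge $uv$ is represented by the two arcs $(u,v)$ and $(v,u)$.
  The strongly connected components of such a digraph are the components of the graph.
\<close>

definition closed_neighborhood :: "'a pair_pre_digraph \<Rightarrow> 'a set \<Rightarrow> 'a set" where
  "closed_neighborhood G X = {v \<in> verts G. v \<in> X \<or> (\<exists>u\<in>X. u \<rightarrow>\<^bsub>G\<^esub> v)}"

definition playable :: "'a pair_pre_digraph \<Rightarrow> 'a set \<Rightarrow> 'a set" where
  "playable G X = {x \<in> verts G.
     \<exists>H \<in> pre_digraph.sccs (G \<restriction> (verts G - closed_neighborhood G X)).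
       card (verts H) \<ge> 2 \<and> (\<exists>v \<in> verts H. x = v \<or> x \<rightarrow>\<^bsub>G\<^esub> v)}"

lemma playable_subset: "playable G X \<subseteq> verts G - X"
proof
  fix x assume "x \<in> playable G X"
  then obtain H v where x: "x \<in> verts G"
    and H: "H \<in> pre_digraph.sccs (G \<restriction> (verts G - closed_neighborhood G X))"
    and v: "v \<in> verts H" "x = v \<or> x \<rightarrow>\<^bsub>G\<^esub> v"
    unfolding playable_def by blast
  have "v \<in> verts G - closed_neighborhood G X"
    using subgraph_imp_subverts[OF induced_imp_subgraph[OF pre_digraph.in_sccs_imp_induced[OF H]]] v(1)
    by auto
  with x v(2) show "x \<in> verts G - X"
    unfolding closed_neighborhood_def by blast
qed

datatype player = Dominator | Staller

text \<open>
  \<open>remaining_moves G p X\<close> is the number of vertices still to be selected, under optimal play, from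
  the position in which \<open>X\<close> is the set of vertices selected so far and player \<open>p\<close> is to move.
  The game is only defined on finite graphs; on an infinite one the value \<open>0\<close> is a dummy.
\<close>

function remaining_moves :: "'a pair_pre_digraph \<Rightarrow> player \<Rightarrow> 'a set \<Rightarrow> nat" where
  "remaining_moves G p X =
     (if infinite (verts G) \<or> playable G X = {} then 0
      else case p of
        Dominator \<Rightarrow> 1 + Min ((\<lambda>x. remaining_moves G Staller (insert x X)) ` playable G X)
      | Staller \<Rightarrow> 1 + Max ((\<lambda>x. remaining_moves G Dominator (insert x X)) ` playable G X))"
  by pat_completeness auto

termination
proof (relation "measure (\<lambda>(G, p, X). card (verts (with_proj G) - X))")
  have *: "card (verts G - insert x X) < card (verts G - X)"
    if "\<not> (infinite (verts G) \<or> playable G X = {})" "x \<in> playable G X"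
    for G :: "'a pair_pre_digraph" and X x
    using that playable_subset[of G X] by (intro psubset_card_mono) auto
  show "((G, Staller, insert x X), (G, p, X)) \<in> measure (\<lambda>(G, p, X). card (verts (with_proj G) - X))"
    if "\<not> (infinite (verts G) \<or> playable G X = {})" "p = Dominator" "x \<in> playable G X"
    for G :: "'a pair_pre_digraph" and p X x
    using *[OF that(1,3)] by simp
  show "((G, Dominator, insert x X), (G, p, X)) \<in> measure (\<lambda>(G, p, X). card (verts (with_proj G) - X))"
    if "\<not> (infinite (verts G) \<or> playable G X = {})" "p = Staller" "x \<in> playable G X"
    for G :: "'a pair_pre_digraph" and p X x
    using *[OF that(1,3)] by simp
qed simp

text \<open>The defining equation loops as an unconditional rewrite rule.\<close>
declare remaining_moves.simps [simp del]

definition game_isolation_number :: "'a pair_pre_digraph \<Rightarrow> nat" (\<open>\<iota>\<^sub>g\<close>) where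
  "\<iota>\<^sub>g G = remaining_moves G Dominator {}"

definition staller_game_isolation_number :: "'a pair_pre_digraph \<Rightarrow> nat" (\<open>\<iota>\<^sub>g''\<close>) where
  "\<iota>\<^sub>g' G = remaining_moves G Staller {}"

definition path_graph :: "nat \<Rightarrow> nat pair_pre_digraph" where
  "path_graph n = \<lparr> pverts = {1..n},
     parcs = {(u, v). u \<in> {1..n} \<and> v \<in> {1..n} \<and> (v = u + 1 \<or> u = v + 1)} \<rparr>"

lemma pair_graph_path_graph: "pair_graph (path_graph n)"
proof
  show "finite (parcs (path_graph n))"
    by (rule finite_subset[of _ "{1..n} \<times> {1..n}"]) (auto simp: path_graph_def)
  show "symmetric (path_graph n)"
    by (auto simp: symmetric_def sym_def arcs_ends_def arc_to_ends_def path_graph_def)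
qed (auto simp: path_graph_def)

end

theory Submission
  imports Defs
begin

text \<open>
  A position is determined by the set \<open>U\<close> of undominated vertices, and a move at \<open>x\<close> deletes
  \<open>x - 1\<close>, \<open>x\<close>, \<open>x + 1\<close> from it. Let \<open>e\<close> be the number of edges inside \<open>U\<close> and \<open>c\<close> the number of
  runs of at least two vertices. Every move lowers \<open>e\<close> by at most 4, while Staller can lower it by
  only 1 by playing a dominated vertex next to a run; this gives the lower bounds. Every move lowers
  \<open>e + 3 * c\<close> by at least 1, while Dominator can lower it by 4 by playing the third vertex of a run;
  this gives the upper bounds. When Staller starts, these bounds are off by one for some residues of
  \<open>n\<close> modulo 5: there the upper bound needs a refinement for positions with two or more runs, and
  the lower bound one for positions containing a run of exactly two vertices.
\<close>

text \<open>The first arc of a path from \<open>v\<close> to another vertex of its component gives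
  an undominated neighbour. Conversely, by symmetry the ends of an undominated edge reach each other
  and so share a component. Components thus disappear from the analysis in favour of single
  edges.\<close>

lemma (in pair_graph) playable_iff:
  "x \<in> playable G X \<longleftrightarrow>
     x \<in> verts G \<and> (\<exists>v w. v \<in> verts G - closed_neighborhood G X \<and>
       w \<in> verts G - closed_neighborhood G X \<and> v \<rightarrow>\<^bsub>G\<^esub> w \<and> (x = v \<or> x \<rightarrow>\<^bsub>G\<^esub> v))"
proof -
  define S where "S = verts G - closed_neighborhood G X"
  interpret H: wf_digraph "G \<restriction> S"
    by (rule wellformed_induce_subgraph)
  have adj: "v \<rightarrow>\<^bsub>G \<restriction> S\<^esub> w \<longleftrightarrow> v \<in> S \<and> w \<in> S \<and> v \<rightarrow>\<^bsub>G\<^esub> w" for v w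
    by (auto simp: arcs_ends_def arc_to_ends_def)
  have "(\<exists>H \<in> pre_digraph.sccs (G \<restriction> S). card (verts H) \<ge> 2 \<and> (\<exists>v \<in> verts H. P v)) \<longleftrightarrow>
        (\<exists>v w. v \<in> S \<and> w \<in> S \<and> v \<rightarrow>\<^bsub>G\<^esub> w \<and> P v)" (is "?A \<longleftrightarrow> ?B") for P
  proof
    assume ?A
    then obtain H v where H: "H \<in> H.sccs" "card (verts H) \<ge> 2" and v: "v \<in> verts H" "P v"
      by blast
    from H(2) have "verts H \<noteq> {v}"
      by auto
    with v(1) obtain w where w: "w \<in> verts H" "w \<noteq> v"
      by blast
    from H(1) have "verts H \<in> H.sccs_verts"
      by (rule H.in_sccs_vertsI_sccs[OF imageI])
    with v(1) w(1) have "v \<rightarrow>\<^sup>*\<^bsub>G \<restriction> S\<^esub> w"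
      by (simp add: H.in_sccs_verts_conv_reachable)
    with w(2) obtain u where "v \<rightarrow>\<^bsub>G \<restriction> S\<^esub> u"
      by (metis H.converse_reachable_cases)
    with adj v(2) show ?B
      by blast
  next
    assume ?B
    then obtain v w where vw: "v \<in> S" "w \<in> S" "v \<rightarrow>\<^bsub>G\<^esub> w" "P v"
      by blast
    then have "v \<rightarrow>\<^bsub>G \<restriction> S\<^esub> w" "w \<rightarrow>\<^bsub>G \<restriction> S\<^esub> v"
      using adj arcs_ends_symmetric[OF sym_arcs] by auto
    then have scc: "{v, w} \<subseteq> H.scc_of v"
      using vw by (auto simp: H.scc_of_def)
    have "H.scc_of v \<in> H.sccs_verts"
      using vw by (intro H.scc_of_in_sccs_verts) simp
    then obtain H where H: "H \<in> H.sccs" "verts H = H.scc_of v"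
      using H.sccs_verts_conv by auto
    have "v \<noteq> w"
      using vw(3) adj_not_same by auto
    moreover have "finite (verts H)"
      using H(1) H.sccs_verts_subsets[OF H.in_sccs_vertsI_sccs[OF imageI, OF H(1)]]
      by (auto simp: S_def intro: finite_subset)
    ultimately have "card (verts H) \<ge> 2"
      using card_mono[of "verts H" "{v, w}"] scc H(2) by auto
    with H scc vw(4) show ?A
      by (intro bexI[of _ H]) auto
  qed
  then show ?thesis
    unfolding playable_def S_def by auto
qed


subsection \<open>Vertex sets of paths\<close>

text \<open>An edge is recorded by its lower end. Integers are used so that shifts such as
  \<open>x - 3\<close> do not truncate.\<close>

definition edges :: "int set \<Rightarrow> int set" where
  "edges U = {v. v \<in> U \<and> v + 1 \<in> U}"

text \<open>A maximal run \<open>{a + 1, \<dots>, b}\<close> of at least two vertices of \<open>U\<close> is recorded by \<open>a\<close>.\<close>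
definition runs :: "int set \<Rightarrow> int set" where
  "runs U = {a. a \<notin> U \<and> a + 1 \<in> U \<and> a + 2 \<in> U}"

definition hit :: "int \<Rightarrow> int set \<Rightarrow> int set" where
  "hit x U = U - {x - 1, x, x + 1}"

text \<open>With weight 3, deleting a run of two vertices (one edge, one run) is worth as much as
  deleting four edges, while splitting a run (four edges lost, one run gained) still costs
  1.\<close>

definition potential :: "int set \<Rightarrow> nat" where
  "potential U = card (edges U) + 3 * card (runs U)"

lemma in_edges [simp]: "v \<in> edges U \<longleftrightarrow> v \<in> U \<and> v + 1 \<in> U"
  by (simp add: edges_def)

lemma in_runs [simp]: "a \<in> runs U \<longleftrightarrow> a \<notin> U \<and> a + 1 \<in> U \<and> a + 2 \<in> U"
  by (simp add: runs_def)

lemma in_hit [simp]: "v \<in> hit x U \<longleftrightarrow> v \<in> U \<and> v \<noteq> x - 1 \<and> v \<noteq> x \<and> v \<noteq> x + 1"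
  by (simp add: hit_def)

section \<open>How a move changes the numbers of edges and runs\<close>

lemma finite_edges [simp]: "finite U \<Longrightarrow> finite (edges U)"
  by (rule finite_subset[of _ U]) auto

lemma finite_runs [simp]: "finite U \<Longrightarrow> finite (runs U)"
  by (rule finite_subset[of _ "(\<lambda>a. a + 1) -` U"]) (auto intro: finite_vimageI)

lemma finite_hit [simp]: "finite U \<Longrightarrow> finite (hit x U)"
  by (simp add: hit_def)

text \<open>A move affects edges and runs only near \<open>x\<close>, so comparing cardinalities
  reduces to a few membership tests in the window \<open>W\<close>.\<close>

lemma card_eq_modulo_window:
  assumes "finite A" "finite B" "finite W" "A - W = B - W"
  shows "int (card A) = int (card B) + (\<Sum>w\<in>W. of_bool (w \<in> A) - of_bool (w \<in> B))"
proof -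
  have "card C = card (C \<inter> W) + card (C - W)" if "finite C" for C
    using sum.Int_Diff[OF that, of "\<lambda>_. 1::nat" W] by simp
  from this[OF assms(1)] this[OF assms(2)] assms(3,4) show ?thesis
    by (simp add: sum_subtractf Int_commute)
qed

lemma card_edges_hit:
  assumes "finite U"
  shows "int (card (edges (hit x U))) = int (card (edges U))
    - of_bool (x - 2 \<in> U \<and> x - 1 \<in> U) - of_bool (x - 1 \<in> U \<and> x \<in> U)
    - of_bool (x \<in> U \<and> x + 1 \<in> U) - of_bool (x + 1 \<in> U \<and> x + 2 \<in> U)"
proof -
  have "edges (hit x U) - {x - 2, x - 1, x, x + 1} = edges U - {x - 2, x - 1, x, x + 1}"
    by auto
  from card_eq_modulo_window[OF _ _ _ this] assms show ?thesis
    by (simp add: add.commute)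
qed

text \<open>Runs recorded at \<open>x - 3\<close> to \<open>x\<close> are destroyed. The only run
  that can appear is the remainder starting at \<open>x + 2\<close>, recorded by
  \<open>x + 1\<close>; it is new only if \<open>x + 1\<close> was in \<open>U\<close>
  before.\<close>

lemma card_runs_hit:
  assumes "finite U"
  shows "int (card (runs (hit x U))) = int (card (runs U))
    - of_bool (x - 3 \<notin> U \<and> x - 2 \<in> U \<and> x - 1 \<in> U) - of_bool (x - 2 \<notin> U \<and> x - 1 \<in> U \<and> x \<in> U)
    - of_bool (x - 1 \<notin> U \<and> x \<in> U \<and> x + 1 \<in> U) - of_bool (x \<notin> U \<and> x + 1 \<in> U \<and> x + 2 \<in> U)
    + of_bool (x + 1 \<in> U \<and> x + 2 \<in> U \<and> x + 3 \<in> U)"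
proof -
  have "runs (hit x U) - {x - 3, x - 2, x - 1, x, x + 1} = runs U - {x - 3, x - 2, x - 1, x, x + 1}"
    by auto
  from card_eq_modulo_window[OF _ _ _ this] assms show ?thesis
    by (cases "x - 1 \<in> U"; cases "x \<in> U"; cases "x + 1 \<in> U"; simp add: add.commute)
qed

lemmas card_hit = card_edges_hit card_runs_hit

text \<open>The interval is the closed neighbourhood of the edge from \<open>v\<close> to
  \<open>v + 1\<close>.\<close>

definition touches :: "int \<Rightarrow> int set \<Rightarrow> bool" where
  "touches x U \<longleftrightarrow> (\<exists>v \<in> edges U. x \<in> {v - 1..v + 2})"

lemma touches_cases:
  assumes "touches x U"
  obtains "x - 2 \<in> U" "x - 1 \<in> U" | "x - 1 \<in> U" "x \<in> U" | "x \<in> U" "x + 1 \<in> U" | "x + 1 \<in> U" "x + 2 \<in> U"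
proof -
  obtain v where v: "v \<in> U" "v + 1 \<in> U" "x \<in> {v - 1..v + 2}"
    using assms by (auto simp: touches_def edges_def)
  then have "v = x - 2 \<or> v = x - 1 \<or> v = x \<or> v = x + 1"
    by auto
  with v show ?thesis
    using that by (auto simp: add.commute)
qed

lemma edges_le_hit:
  assumes "finite U"
  shows "card (edges U) \<le> card (edges (hit x U)) + 4"
  using card_edges_hit[OF assms, of x]
  by (cases "x - 2 \<in> U"; cases "x - 1 \<in> U"; cases "x \<in> U"; cases "x + 1 \<in> U";
      cases "x + 2 \<in> U"; simp)

lemma edges_hit_less:
  assumes "finite U" "touches x U"
  shows "card (edges (hit x U)) < card (edges U)"
  using assms(2) card_edges_hit[OF assms(1), of x]
  by (cases rule: touches_cases)
     (cases "x - 2 \<in> U"; cases "x - 1 \<in> U"; cases "x \<in> U"; cases "x + 1 \<in> U";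
      cases "x + 2 \<in> U"; simp)+

text \<open>The number of runs grows only if \<open>x - 3\<close>, ..., \<open>x + 3\<close> all lie
  in \<open>U\<close>; then four edges are lost against a gain of 3. Otherwise losing one edge
  suffices.\<close>

lemma potential_hit_less:
  assumes "finite U" "touches x U"
  shows "potential (hit x U) < potential U"
  using assms(2) card_hit[OF assms(1), of x] unfolding potential_def
  by (cases rule: touches_cases)
     (cases "x - 2 \<in> U"; cases "x - 1 \<in> U"; cases "x \<in> U"; cases "x + 1 \<in> U";
      cases "x + 2 \<in> U"; cases "x - 3 \<in> U"; cases "x + 3 \<in> U"; simp)+

lemma potential_hit_less_runs:
  assumes "finite U" "touches x U" "card (runs (hit x U)) < card (runs U)"
  shows "potential (hit x U) + 4 \<le> potential U"
  using edges_hit_less[OF assms(1,2)] assms(3) by (simp add: potential_def)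

section \<open>Boundaries of runs and moves for Dominator\<close>

lemma ex_boundary_below:
  fixes U :: "int set"
  assumes "y \<notin> U" "y < v"
  obtains a where "y \<le> a" "a < v" "a \<notin> U" "\<And>w. a < w \<Longrightarrow> w < v \<Longrightarrow> w \<in> U"
proof -
  define m where "m = Max ({y..<v} - U)"
  have *: "finite ({y..<v} - U)" "{y..<v} - U \<noteq> {}"
    using assms by auto
  have m: "m \<in> {y..<v} - U"
    unfolding m_def using * by (rule Max_in)
  have "w \<in> U" if "m < w" "w < v" for w
    using Max_ge[OF *(1), of w] m that by (fastforce simp flip: m_def)
  with m show ?thesis
    using that[of m] by auto
qed

lemma ex_boundary_above:
  fixes U :: "int set"
  assumes "y \<notin> U" "v < y"
  obtains a where "v < a" "a \<le> y" "a \<notin> U" "\<And>w. v < w \<Longrightarrow> w < a \<Longrightarrow> w \<in> U"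
proof -
  define m where "m = Min ({v<..y} - U)"
  have *: "finite ({v<..y} - U)" "{v<..y} - U \<noteq> {}"
    using assms by auto
  have m: "m \<in> {v<..y} - U"
    unfolding m_def using * by (rule Min_in)
  have "w \<in> U" if "v < w" "w < m" for w
    using Min_le[OF *(1), of w] m that by (fastforce simp flip: m_def)
  with m show ?thesis
    using that[of m] by auto
qed

lemma finite_ex_notin_below:
  fixes U :: "int set"
  assumes "finite U"
  shows "\<exists>y<v. y \<notin> U"
proof (rule ccontr)
  assume "\<not> ?thesis"
  then have "{..<v} \<subseteq> U"
    by auto
  with assms show False
    using finite_subset infinite_Iio by blast
qed

text \<open>Dominator plays the third vertex of a run, leaving its first vertex isolated.\<close>
lemma ex_Dominator_move_long_run:
  assumes "finite U" "v \<in> U" "v + 1 \<in> U" "v + 2 \<in> U"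
  shows "\<exists>x\<in>U. touches x U \<and> potential (hit x U) + 4 \<le> potential U \<and>
    (card (runs (hit x U)) < card (runs U) \<longrightarrow>
      potential (hit x U) + 5 \<le> potential U \<and> card (runs U) = card (runs (hit x U)) + 1)"
proof -
  obtain y where "y < v" "y \<notin> U"
    using finite_ex_notin_below[OF assms(1)] by blast
  then obtain a where a: "a < v" "a \<notin> U" "\<And>w. a < w \<Longrightarrow> w < v \<Longrightarrow> w \<in> U"
    using ex_boundary_below by metis
  have run: "a + 1 \<in> U" "a + 2 \<in> U" "a + 3 \<in> U"
    using a assms(2-4) by (smt (verit))+
  then have "touches (a + 3) U"
    unfolding touches_def by (intro bexI[of _ "a + 2"]) (auto simp: add.commute)
  \<comment> \<open>A run of six or more vertices loses four edges and leaves a shorter run, a drop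
    of 4. A run of three, four or five vertices loses two, three or four edges and disappears as a
    run, a drop of at least 5.\<close>
  moreover have "potential (hit (a + 3) U) + 4 \<le> potential U \<and>
    (card (runs (hit (a + 3) U)) < card (runs U) \<longrightarrow>
      potential (hit (a + 3) U) + 5 \<le> potential U \<and>
      card (runs U) = card (runs (hit (a + 3) U)) + 1)"
    using card_hit[OF assms(1), of "a + 3"] run a(2) unfolding potential_def
    by (cases "a + 4 \<in> U"; cases "a + 5 \<in> U"; cases "a + 6 \<in> U"; simp add: algebra_simps)
  ultimately show ?thesis
    using run by blast
qed

definition short_run :: "int set \<Rightarrow> int \<Rightarrow> bool" where
  "short_run U a \<longleftrightarrow> a \<notin> U \<and> a + 1 \<in> U \<and> a + 2 \<in> U \<and> a + 3 \<notin> U"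

lemma short_run_edge:
  assumes "\<nexists>v. v \<in> U \<and> v + 1 \<in> U \<and> v + 2 \<in> U" "v \<in> edges U"
  shows "short_run U (v - 1)"
proof -
  have "\<not> (v - 1 \<in> U \<and> v - 1 + 1 \<in> U \<and> v - 1 + 2 \<in> U)" "\<not> (v \<in> U \<and> v + 1 \<in> U \<and> v + 2 \<in> U)"
    using assms(1) by blast+
  with assms(2) show ?thesis
    by (auto simp: short_run_def add.commute)
qed

text \<open>Every run is then a single edge, and the run recorded by \<open>a\<close> has the edge
  \<open>a + 1\<close>.\<close>

lemma card_edges_eq_card_runs:
  assumes "\<nexists>v. v \<in> U \<and> v + 1 \<in> U \<and> v + 2 \<in> U"
  shows "card (edges U) = card (runs U)"
proof -
  have "edges U = (\<lambda>a. a + 1) ` runs U"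
  proof (intro equalityI subsetI)
    fix v assume "v \<in> edges U"
    from short_run_edge[OF assms this] have "v - 1 \<in> runs U"
      by (simp add: short_run_def)
    then show "v \<in> (\<lambda>a. a + 1) ` runs U"
      by (intro image_eqI[of _ _ "v - 1"]) simp_all
  qed (auto simp: add.commute)
  then show ?thesis
    by (simp add: card_image)
qed

text \<open>The move suits both players: Dominator gains a potential drop of 4, Staller gives up
  just one edge.\<close>

lemma hit_short_run:
  assumes "finite U" "short_run U a"
  shows "touches (a + 2) U" "card (edges (hit (a + 2) U)) + 1 = card (edges U)"
    "card (runs (hit (a + 2) U)) + 1 = card (runs U)" "potential (hit (a + 2) U) + 4 = potential U"
proof -
  have a: "a \<notin> U" "a + 1 \<in> U" "a + 2 \<in> U" "a + 3 \<notin> U"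
    using assms(2) by (auto simp: short_run_def)
  show "touches (a + 2) U"
    unfolding touches_def using a by (intro bexI[of _ "a + 1"]) (auto simp: add.commute)
  show "card (edges (hit (a + 2) U)) + 1 = card (edges U)"
    "card (runs (hit (a + 2) U)) + 1 = card (runs U)"
    using card_hit[OF assms(1), of "a + 2"] a
    by (cases "a + 4 \<in> U"; cases "a - 1 \<in> U"; simp add: algebra_simps)+
  then show "potential (hit (a + 2) U) + 4 = potential U"
    by (simp add: potential_def)
qed

lemma ex_Dominator_move:
  assumes "finite U" "edges U \<noteq> {}"
  shows "\<exists>x\<in>U. touches x U \<and> potential (hit x U) + 4 \<le> potential U"
proof (cases "\<exists>v. v \<in> U \<and> v + 1 \<in> U \<and> v + 2 \<in> U")
  case True
  then show ?thesis
    using ex_Dominator_move_long_run[OF assms(1)] by metis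
next
  case False
  obtain v where v: "v \<in> U" "v + 1 \<in> U"
    using assms(2) by auto
  then have "short_run U (v - 1)"
    using short_run_edge[OF False] by simp
  from hit_short_run[OF assms(1) this]
  have "touches (v + 1) U" "potential (hit (v + 1) U) + 4 = potential U"
    by (simp_all add: algebra_simps)
  with v(2) show ?thesis
    by (intro bexI[of _ "v + 1"]) auto
qed

section \<open>Gaps of at least two vertices and moves for Staller\<close>

definition wide_gaps :: "int set \<Rightarrow> bool" where
  "wide_gaps U \<longleftrightarrow> (\<forall>y. y \<notin> U \<longrightarrow> y - 1 \<notin> U \<or> y + 1 \<notin> U)"

lemma wide_gapsD: "wide_gaps U \<Longrightarrow> y \<notin> U \<Longrightarrow> y - 1 \<in> U \<Longrightarrow> y + 1 \<in> U \<Longrightarrow> False"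
  by (auto simp: wide_gaps_def)

text \<open>Walking from the edge towards \<open>y\<close>, the first vertex \<open>x\<close>
  outside \<open>U\<close> borders the run of that edge. By \<open>wide_gaps\<close> its other
  neighbour is outside \<open>U\<close> too, so only one edge is lost. The bounds on
  \<open>x\<close> will place it on the path, and the last conclusion says that a run of three or
  more vertices is the one bordered.\<close>

lemma ex_hit_next_to_run:
  assumes "finite U" "wide_gaps U" "y \<notin> U" "v \<in> U" "v + 1 \<in> U"
  obtains x where "x \<notin> U" "min y v \<le> x" "x \<le> max y v" "touches x U"
    "card (edges (hit x U)) + 1 = card (edges U)"
    "v + 2 \<in> U \<Longrightarrow> x + 1 \<in> U \<and> x + 2 \<in> U \<and> x + 3 \<in> U \<or> x - 1 \<in> U \<and> x - 2 \<in> U \<and> x - 3 \<in> U"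
proof (cases "y < v")
  case True
  then obtain a where a: "y \<le> a" "a < v" "a \<notin> U" "\<And>w. a < w \<Longrightarrow> w < v \<Longrightarrow> w \<in> U"
    using ex_boundary_below[OF assms(3)] by metis
  have *: "a + 1 \<in> U" "a + 2 \<in> U"
    using a assms(4,5) by (smt (verit))+
  then have "a - 1 \<notin> U"
    using wide_gapsD[OF assms(2) a(3)] by blast
  show ?thesis
  proof (rule that[OF a(3)])
    show "touches a U"
      unfolding touches_def using * by (intro bexI[of _ "a + 1"]) (auto simp: add.commute)
    show "card (edges (hit a U)) + 1 = card (edges U)"
      using card_edges_hit[OF assms(1), of a] * a(3) \<open>a - 1 \<notin> U\<close> by simp
    show "a + 1 \<in> U \<and> a + 2 \<in> U \<and> a + 3 \<in> U \<or> a - 1 \<in> U \<and> a - 2 \<in> U \<and> a - 3 \<in> U"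
      if "v + 2 \<in> U"
      using * a that assms(4,5) by (smt (verit))
  qed (use a in auto)
next
  case False
  with assms(3,4) have "v < y"
    by (metis linorder_less_linear)
  then obtain a where a: "v < a" "a \<le> y" "a \<notin> U" "\<And>w. v < w \<Longrightarrow> w < a \<Longrightarrow> w \<in> U"
    using ex_boundary_above[OF assms(3)] by metis
  have *: "a - 1 \<in> U" "a - 2 \<in> U"
    using a assms(4,5) by (smt (verit))+
  then have "a + 1 \<notin> U"
    using wide_gapsD[OF assms(2) a(3)] by blast
  show ?thesis
  proof (rule that[OF a(3)])
    show "touches a U"
      unfolding touches_def using * by (intro bexI[of _ "a - 2"]) auto
    show "card (edges (hit a U)) + 1 = card (edges U)"
      using card_edges_hit[OF assms(1), of a] * a(3) \<open>a + 1 \<notin> U\<close> by simp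
    show "a + 1 \<in> U \<and> a + 2 \<in> U \<and> a + 3 \<in> U \<or> a - 1 \<in> U \<and> a - 2 \<in> U \<and> a - 3 \<in> U"
      if "v + 2 \<in> U"
      using * a that assms(4,5) by (smt (verit))
  qed (use a in auto)
qed

lemma short_run_hit_far:
  assumes "short_run U a" "x < a \<or> a + 3 < x"
  shows "short_run (hit x U) a"
  using assms by (auto simp: short_run_def)

text \<open>Wide gaps keep \<open>a - 1\<close> and \<open>a + 4\<close> out of \<open>U\<close>, so
  the pair carries the only edge that such a move can delete.\<close>

lemma short_run_hit_near:
  assumes "finite U" "wide_gaps U" "short_run U a" "a \<le> x" "x \<le> a + 3"
  shows "card (edges U) \<le> card (edges (hit x U)) + 1"
proof -
  have a: "a \<notin> U" "a + 1 \<in> U" "a + 2 \<in> U" "a + 3 \<notin> U"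
    using assms(3) by (auto simp: short_run_def)
  have "a - 1 \<notin> U" "a + 4 \<notin> U"
    using wide_gapsD[OF assms(2), of a] wide_gapsD[OF assms(2), of "a + 3"] a
    by (auto simp: add.commute)
  moreover have "x = a \<or> x = a + 1 \<or> x = a + 2 \<or> x = a + 3"
    using assms(4,5) by arith
  ultimately show ?thesis
    using card_edges_hit[OF assms(1), of x] a by (auto simp: algebra_simps)
qed


subsection \<open>The game on a path\<close>

definition undominated :: "nat \<Rightarrow> nat set \<Rightarrow> int set" where
  "undominated n X = {v \<in> {1..int n}. \<forall>x\<in>X. 1 < \<bar>int x - v\<bar>}"

lemma finite_undominated [simp]: "finite (undominated n X)"
  by (rule finite_subset[of _ "{1..int n}"]) (auto simp: undominated_def)

lemma undominated_empty: "undominated n {} = {1..int n}"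
  by (auto simp: undominated_def)

lemma undominated_insert: "undominated n (insert x X) = hit (int x) (undominated n X)"
  by (auto simp: undominated_def)

lemma undominated_nat:
  assumes "v \<in> undominated n X"
  obtains k where "v = int k" "k \<in> {1..n}"
  using assms by (intro that[of "nat v"]) (auto simp: undominated_def)

text \<open>A selected vertex dominates a block of three consecutive integers, so with
  \<open>y\<close> the block contains \<open>y - 1\<close> or \<open>y + 1\<close>. Beyond the ends
  of the path everything is outside the set.\<close>

lemma wide_gaps_undominated:
  assumes "X \<subseteq> {1..n}"
  shows "wide_gaps (undominated n X)"
  unfolding wide_gaps_def
proof (intro allI impI)
  fix y assume y: "y \<notin> undominated n X"
  show "y - 1 \<notin> undominated n X \<or> y + 1 \<notin> undominated n X"
  proof (cases "y \<in> {1..int n}")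
    case True
    with y obtain x where "x \<in> X" "\<bar>int x - y\<bar> \<le> 1"
      by (auto simp: undominated_def)
    then have "\<bar>int x - (y - 1)\<bar> \<le> 1 \<or> \<bar>int x - (y + 1)\<bar> \<le> 1"
      by arith
    with \<open>x \<in> X\<close> show ?thesis
      by (auto simp: undominated_def not_less)
  qed (auto simp: undominated_def)
qed

lemma path_graph_verts: "verts (path_graph n) = {1..n}"
  by (simp add: path_graph_def)

lemma path_graph_dominates:
  "u \<rightarrow>\<^bsub>path_graph n\<^esub> v \<longleftrightarrow> u \<in> {1..n} \<and> v \<in> {1..n} \<and> (v = u + 1 \<or> u = v + 1)"
  by (auto simp: path_graph_def arcs_ends_def arc_to_ends_def)

lemma undominated_path_graph:
  assumes "X \<subseteq> {1..n}"
  shows "v \<in> verts (path_graph n) - closed_neighborhood (path_graph n) X \<longleftrightarrow>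
    int v \<in> undominated n X"
proof -
  have "(v \<in> X \<or> (\<exists>u\<in>X. u \<rightarrow>\<^bsub>path_graph n\<^esub> v)) \<longleftrightarrow> (\<exists>x\<in>X. \<bar>int x - int v\<bar> \<le> 1)" if "v \<in> {1..n}"
  proof -
    have "v = x \<or> x \<rightarrow>\<^bsub>path_graph n\<^esub> v \<longleftrightarrow> \<bar>int x - int v\<bar> \<le> 1" if "x \<in> X" for x
      using that assms \<open>v \<in> {1..n}\<close> unfolding path_graph_dominates by auto
    then show ?thesis
      by blast
  qed
  then have "v \<in> verts (path_graph n) - closed_neighborhood (path_graph n) X \<longleftrightarrow>
      v \<in> {1..n} \<and> \<not> (\<exists>x\<in>X. \<bar>int x - int v\<bar> \<le> 1)"
    unfolding closed_neighborhood_def path_graph_verts by blast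
  then show ?thesis
    by (auto simp: undominated_def not_le)
qed

lemma playable_path_graph:
  assumes "X \<subseteq> {1..n}"
  shows "x \<in> playable (path_graph n) X \<longleftrightarrow> x \<in> {1..n} \<and> touches (int x) (undominated n X)"
proof -
  interpret pair_graph "path_graph n"
    by (rule pair_graph_path_graph)
  let ?U = "undominated n X"
  have "(\<exists>v w. int v \<in> ?U \<and> int w \<in> ?U \<and> v \<rightarrow>\<^bsub>path_graph n\<^esub> w \<and> (x = v \<or> x \<rightarrow>\<^bsub>path_graph n\<^esub> v))
    \<longleftrightarrow> touches (int x) ?U" (is "?L \<longleftrightarrow> ?R") if "x \<in> {1..n}"
  proof
    assume ?L
    then obtain v w where vw: "int v \<in> ?U" "int w \<in> ?U" "w = v + 1 \<or> v = w + 1"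
      "x = v \<or> v = x + 1 \<or> x = v + 1"
      unfolding path_graph_dominates by blast
    from vw(3) show ?R
    proof
      assume "w = v + 1"
      with vw show ?thesis
        unfolding touches_def by (intro bexI[of _ "int v"]) (auto simp: add.commute)
    next
      assume "v = w + 1"
      with vw show ?thesis
        unfolding touches_def by (intro bexI[of _ "int w"]) (auto simp: add.commute)
    qed
  next
    assume ?R
    then obtain v where v: "v \<in> ?U" "v + 1 \<in> ?U" "int x \<in> {v - 1..v + 2}"
      by (auto simp: touches_def)
    obtain k where k: "v = int k" "k \<in> {1..n}"
      using v(1) by (rule undominated_nat)
    have k': "k \<in> {1..n}" "k + 1 \<in> {1..n}" "int k \<in> ?U" "int (k + 1) \<in> ?U"
      using v k by (auto simp: undominated_def add.commute)
    \<comment> \<open>The first two positions are in the closed neighbourhood of \<open>k\<close>,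
      the last two in that of \<open>k + 1\<close>.\<close>
    have "(x = k \<or> k = x + 1) \<or> (x = k + 1 \<or> x = k + 1 + 1)"
      using v(3) k by auto
    then show ?L
    proof
      assume "x = k \<or> k = x + 1"
      then show ?thesis
        using that k' unfolding path_graph_dominates by (intro exI[of _ k] exI[of _ "k + 1"]) blast
    next
      assume "x = k + 1 \<or> x = k + 1 + 1"
      then show ?thesis
        using that k' unfolding path_graph_dominates by (intro exI[of _ "k + 1"] exI[of _ k]) blast
    qed
  qed
  then show ?thesis
    unfolding playable_iff undominated_path_graph[OF assms] unfolding path_graph_verts by blast
qed

section \<open>Bounding the value of a position by one move or by all moves\<close>

abbreviation path_moves :: "nat \<Rightarrow> player \<Rightarrow> nat set \<Rightarrow> nat" where
  "path_moves n \<equiv> remaining_moves (path_graph n)"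

lemma finite_playable_path: "finite (playable (path_graph n) X)"
  by (rule finite_subset[OF subset_trans[OF playable_subset Diff_subset]]) (simp add: path_graph_def)

lemma path_moves_no_edges:
  assumes "X \<subseteq> {1..n}" "edges (undominated n X) = {}"
  shows "path_moves n p X = 0"
proof -
  have "playable (path_graph n) X = {}"
    using assms(2) by (auto simp: playable_path_graph[OF assms(1)] touches_def)
  then show ?thesis
    by (subst remaining_moves.simps) simp
qed

lemma path_moves_Dominator:
  assumes "playable (path_graph n) X \<noteq> {}"
  shows "path_moves n Dominator X =
    1 + Min ((\<lambda>x. path_moves n Staller (insert x X)) ` playable (path_graph n) X)"
  using assms by (subst remaining_moves.simps) (simp add: path_graph_def)

lemma path_moves_Staller:
  assumes "playable (path_graph n) X \<noteq> {}"
  shows "path_moves n Staller X =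
    1 + Max ((\<lambda>x. path_moves n Dominator (insert x X)) ` playable (path_graph n) X)"
  using assms by (subst remaining_moves.simps) (simp add: path_graph_def)

lemma playable_nonempty:
  assumes "X \<subseteq> {1..n}" "edges (undominated n X) \<noteq> {}"
  shows "playable (path_graph n) X \<noteq> {}"
proof -
  obtain v where v: "v \<in> edges (undominated n X)"
    using assms(2) by blast
  then obtain k where "v = int k" "k \<in> {1..n}"
    using undominated_nat[of v n X] by auto
  with v have "k \<in> playable (path_graph n) X"
    unfolding playable_path_graph[OF assms(1)] touches_def by (auto intro!: bexI[of _ v])
  then show ?thesis
    by blast
qed

lemma Dominator_le:
  assumes "X \<subseteq> {1..n}" "x \<in> {1..n}" "touches (int x) (undominated n X)"
    "path_moves n Staller (insert x X) \<le> b"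
  shows "path_moves n Dominator X \<le> b + 1"
proof -
  have x: "x \<in> playable (path_graph n) X"
    using assms playable_path_graph by blast
  then have "Min ((\<lambda>x. path_moves n Staller (insert x X)) ` playable (path_graph n) X) \<le> b"
    by (intro order_trans[OF Min_le assms(4)]) (auto simp: finite_playable_path)
  with x show ?thesis
    by (subst path_moves_Dominator) auto
qed

lemma Staller_ge:
  assumes "X \<subseteq> {1..n}" "x \<in> {1..n}" "touches (int x) (undominated n X)"
    "b \<le> path_moves n Dominator (insert x X)"
  shows "b + 1 \<le> path_moves n Staller X"
proof -
  have x: "x \<in> playable (path_graph n) X"
    using assms playable_path_graph by blast
  then have "b \<le> Max ((\<lambda>x. path_moves n Dominator (insert x X)) ` playable (path_graph n) X)"
    by (intro order_trans[OF assms(4) Max_ge]) (auto simp: finite_playable_path)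
  with x show ?thesis
    by (subst path_moves_Staller) auto
qed

text \<open>The second hypothesis ensures that a move exists, so that the extra 1 is
  counted.\<close>

lemma Dominator_ge:
  assumes "X \<subseteq> {1..n}" "edges (undominated n X) \<noteq> {}"
    "\<And>x. x \<in> {1..n} \<Longrightarrow> touches (int x) (undominated n X) \<Longrightarrow> b \<le> path_moves n Staller (insert x X)"
  shows "b + 1 \<le> path_moves n Dominator X"
  using playable_nonempty[OF assms(1,2)] assms(3)
  by (subst path_moves_Dominator) (auto simp: finite_playable_path playable_path_graph[OF assms(1)])

lemma Staller_le:
  assumes "X \<subseteq> {1..n}"
    "\<And>x. x \<in> {1..n} \<Longrightarrow> touches (int x) (undominated n X) \<Longrightarrow> path_moves n Dominator (insert x X) \<le> b"
  shows "path_moves n Staller X \<le> b + 1"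
proof (cases "edges (undominated n X) = {}")
  case False
  then show ?thesis
    using playable_nonempty[OF assms(1)] assms(2)
    by (subst path_moves_Staller) (auto simp: finite_playable_path playable_path_graph[OF assms(1)])
qed (simp add: path_moves_no_edges[OF assms(1)])


subsection \<open>Upper bounds\<close>

text \<open>Compares the bound of \<open>path_moves_le\<close> for Staller with a single quotient,
  the form used with two or more runs and in the final formula.\<close>

lemma div5_add_div5_Suc_le: "n div 5 + (n + 1) div 5 \<le> 2 * n div 5" for n :: nat
proof (cases "n mod 5 = 4")
  case True
  then have "n = 5 * (n div 5) + 4"
    using mult_div_mod_eq[of 5 n] by simp
  then have "(n + 1) div 5 \<le> n div 5 + 1" "2 * (n div 5) + 1 \<le> 2 * n div 5"
    by linarith+
  then show ?thesis
    by linarith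
next
  case False
  then have "n mod 5 \<le> 3"
    using mod_less_divisor[of 5 n] by linarith
  then have "n \<le> 5 * (n div 5) + 3"
    using mult_div_mod_eq[of 5 n] by linarith
  then have "(n + 1) div 5 \<le> n div 5" "2 * (n div 5) \<le> 2 * n div 5"
    by linarith+
  then show ?thesis
    by linarith
qed

text \<open>Dominator can lower the potential by 4 and Staller must lower it by at least 1, so a
  pair of moves uses up 5. The two quotients count the moves of the two players separately.\<close>

lemma path_moves_le:
  assumes "X \<subseteq> {1..n}" "t = potential (undominated n X)"
  shows "path_moves n Dominator X \<le> (t + 1) div 5 + (t - 3) div 5"
    "path_moves n Staller X \<le> t div 5 + (t + 1) div 5"
proof -
  have "path_moves n Dominator X \<le> (t + 1) div 5 + (t - 3) div 5 \<and>
    path_moves n Staller X \<le> t div 5 + (t + 1) div 5"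
    using assms
  proof (induction t arbitrary: X rule: less_induct)
    case (less t)
    let ?U = "undominated n X"
    show ?case
    proof (cases "edges ?U = {}")
      case True
      then show ?thesis
        using path_moves_no_edges[OF less.prems(1)] by simp
    next
      case False
      have t: "t = potential ?U"
        by (rule less.prems(2))
      \<comment> \<open>Ensures that \<open>t - 3\<close> and \<open>t - 4\<close> do not
        truncate.\<close>
      have t4: "4 \<le> t"
        using ex_Dominator_move[OF _ False] t by auto
      obtain y where y: "y \<in> ?U" "touches y ?U" "potential (hit y ?U) + 4 \<le> t"
        using ex_Dominator_move[OF _ False] t by auto
      obtain x where x: "y = int x" "x \<in> {1..n}"
        using y(1) by (rule undominated_nat)
      define t' where "t' = potential (undominated n (insert x X))"
      have t': "t' + 4 \<le> t"
        using y x by (simp add: t'_def undominated_insert)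
      have "path_moves n Staller (insert x X) \<le> t' div 5 + (t' + 1) div 5"
        using less.IH[OF _ _ t'_def] t' less.prems(1) x by simp
      then have "path_moves n Dominator X \<le> t' div 5 + (t' + 1) div 5 + 1"
        using less.prems(1) x y(2) by (intro Dominator_le[of X n x]) auto
      also have "\<dots> \<le> (t + 1) div 5 + (t - 3) div 5"
        using t' div_le_mono[of t' "t - 4" 5] div_le_mono[of "t' + 1" "t - 3" 5] by linarith
      finally have D: "path_moves n Dominator X \<le> (t + 1) div 5 + (t - 3) div 5" .
      have "path_moves n Staller X \<le> (t div 5 + (t - 4) div 5) + 1"
      proof (rule Staller_le[OF less.prems(1)])
        fix x assume x: "x \<in> {1..n}" "touches (int x) ?U"
        define t' where "t' = potential (undominated n (insert x X))"
        have t': "t' < t"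
          using potential_hit_less[OF _ x(2)] t by (simp add: t'_def undominated_insert)
        have "path_moves n Dominator (insert x X) \<le> (t' + 1) div 5 + (t' - 3) div 5"
          using less.IH[OF t' _ t'_def] less.prems(1) x by simp
        also have "\<dots> \<le> t div 5 + (t - 4) div 5"
          using t' by (intro add_mono div_le_mono) auto
        finally show "path_moves n Dominator (insert x X) \<le> t div 5 + (t - 4) div 5" .
      qed
      also have "\<dots> \<le> t div 5 + (t + 1) div 5"
        using t4 by linarith
      finally show ?thesis
        using D by blast
    qed
  qed
  then show "path_moves n Dominator X \<le> (t + 1) div 5 + (t - 3) div 5"
    "path_moves n Staller X \<le> t div 5 + (t + 1) div 5"
    by blast+
qed

text \<open>With at least two runs, whoever finishes a run of three or more vertices wastes part of his
  move, which sharpens the bounds for some residues.\<close>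
lemma path_moves_two_runs_le:
  assumes "X \<subseteq> {1..n}" "t = potential (undominated n X)" "2 \<le> card (runs (undominated n X))"
  shows "path_moves n Dominator X \<le> (2 * t - 5) div 5" "path_moves n Staller X \<le> (2 * t - 2) div 5"
proof -
  have "path_moves n Dominator X \<le> (2 * t - 5) div 5 \<and> path_moves n Staller X \<le> (2 * t - 2) div 5"
    using assms
  proof (induction t arbitrary: X rule: less_induct)
    case (less t)
    let ?U = "undominated n X"
    have t: "t = potential ?U"
      by (rule less.prems(2))
    have "runs ?U \<noteq> {}"
      using less.prems(3) by auto
    then obtain a where "a \<in> runs ?U"
      by blast
    then obtain v where v: "v \<in> edges ?U"
      using that[of "a + 1"] by (auto simp: add.commute)
    have edges_ge: "card (runs ?U) \<le> card (edges ?U)"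
      by (rule card_inj_on_le[of "\<lambda>a. a + 1"]) (auto simp: add.commute)
    \<comment> \<open>Two runs contribute at least two edges and weight 6.\<close>
    then have t8: "8 \<le> t"
      using less.prems(3) t by (simp add: potential_def)
    have D: "path_moves n Dominator X \<le> (2 * t - 5) div 5"
    proof (cases "\<exists>v. v \<in> ?U \<and> v + 1 \<in> ?U \<and> v + 2 \<in> ?U")
      case True
      then obtain y where y: "y \<in> ?U" "touches y ?U" "potential (hit y ?U) + 4 \<le> potential ?U"
        "card (runs (hit y ?U)) < card (runs ?U) \<Longrightarrow>
          potential (hit y ?U) + 5 \<le> potential ?U \<and> card (runs ?U) = card (runs (hit y ?U)) + 1"
        using ex_Dominator_move_long_run[OF finite_undominated] by metis
      obtain x where x: "y = int x" "x \<in> {1..n}"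
        using y(1) by (rule undominated_nat)
      define t' where "t' = potential (undominated n (insert x X))"
      have t': "t' + 4 \<le> t"
        using y x t by (simp add: t'_def undominated_insert)
      have X': "insert x X \<subseteq> {1..n}"
        using x less.prems(1) by simp
      have "path_moves n Staller (insert x X) + 1 \<le> (2 * t - 5) div 5"
      proof (cases "2 \<le> card (runs (undominated n (insert x X)))")
        case True
        then have "path_moves n Staller (insert x X) \<le> (2 * t' - 2) div 5"
          using less.IH[OF _ X' t'_def] t' by simp
        with t' t8 show ?thesis
          by linarith
      next
        \<comment> \<open>Fewer than two runs remain, so the number of runs fell and the drop is 5
          rather than 4. This pays for falling back on the weaker
          \<open>path_moves_le\<close>.\<close>
        case False
        then have "t' + 5 \<le> t"
          using y(4) x less.prems(3) t by (simp add: t'_def undominated_insert)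
        with path_moves_le(2)[OF X' t'_def] div5_add_div5_Suc_le[of t'] t8 show ?thesis
          by linarith
      qed
      with Dominator_le[OF less.prems(1) x(2) _ order_refl] y(2) x(1) show ?thesis
        by auto
    next
      case no3: False
      from hit_short_run[OF finite_undominated short_run_edge[OF no3 v]]
      have hit: "touches (v + 1) ?U" "card (runs (hit (v + 1) ?U)) + 1 = card (runs ?U)"
        "potential (hit (v + 1) ?U) + 4 = potential ?U"
        by (simp_all add: algebra_simps)
      have "v + 1 \<in> ?U"
        using v by simp
      then obtain x where x: "v + 1 = int x" "x \<in> {1..n}"
        by (rule undominated_nat)
      define t' where "t' = potential (undominated n (insert x X))"
      have t': "t' + 4 = t"
        using hit x t by (simp add: t'_def undominated_insert)
      have X': "insert x X \<subseteq> {1..n}"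
        using x less.prems(1) by simp
      have "path_moves n Staller (insert x X) + 1 \<le> (2 * t - 5) div 5"
      proof (cases "2 \<le> card (runs (undominated n (insert x X)))")
        case True
        then have "path_moves n Staller (insert x X) \<le> (2 * t' - 2) div 5"
          using less.IH[OF _ X' t'_def] t' by simp
        with t' t8 show ?thesis
          by linarith
      next
        \<comment> \<open>All runs being pairs, there were exactly two of them and
          \<open>t = 8\<close>; one pair remains, worth one more move.\<close>
        case False
        then have "card (runs ?U) = 2"
          using hit(2) x less.prems(3) by (simp add: undominated_insert)
        moreover have "card (edges ?U) = card (runs ?U)"
          by (rule card_edges_eq_card_runs[OF no3])
        ultimately have "t = 8"
          using t by (simp add: potential_def)
        with path_moves_le(2)[OF X' t'_def] t' show ?thesis
          by auto
      qed
      with Dominator_le[OF less.prems(1) x(2) _ order_refl] hit(1) x(1) show ?thesis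
        by auto
    qed
    have "path_moves n Staller X \<le> (2 * t - 7) div 5 + 1"
    proof (rule Staller_le[OF less.prems(1)])
      fix x assume x: "x \<in> {1..n}" "touches (int x) ?U"
      define t' where "t' = potential (undominated n (insert x X))"
      have t': "t' < t"
        using potential_hit_less[OF _ x(2)] t by (simp add: t'_def undominated_insert)
      have X': "insert x X \<subseteq> {1..n}"
        using x less.prems(1) by simp
      show "path_moves n Dominator (insert x X) \<le> (2 * t - 7) div 5"
      proof (cases "2 \<le> card (runs (undominated n (insert x X)))")
        case True
        then have "path_moves n Dominator (insert x X) \<le> (2 * t' - 5) div 5"
          using less.IH[OF t' X' t'_def] by simp
        also have "\<dots> \<le> (2 * t - 7) div 5"
          using t' by (intro div_le_mono) auto
        finally show ?thesis .
      next
        \<comment> \<open>Staller has reduced the number of runs, which costs at least 4 and again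
          allows \<open>path_moves_le\<close>.\<close>
        case False
        then have "t' + 4 \<le> t"
          using potential_hit_less_runs[OF _ x(2)] t less.prems(3)
          by (simp add: t'_def undominated_insert)
        with path_moves_le(1)[OF X' t'_def] t8 show ?thesis
          by linarith
      qed
    qed
    also have "\<dots> \<le> (2 * t - 2) div 5"
      using t8 by linarith
    finally show ?case
      using D by blast
  qed
  then show "path_moves n Dominator X \<le> (2 * t - 5) div 5" "path_moves n Staller X \<le> (2 * t - 2) div 5"
    by blast+
qed


subsection \<open>Lower bounds\<close>

text \<open>Any selected vertex serves as the dominated vertex \<open>y\<close> of
  \<open>ex_hit_next_to_run\<close>; this is why \<open>X\<close> must be nonempty. The move found
  lies between \<open>y\<close> and \<open>v\<close>, hence on the path.\<close>

lemma ex_Staller_move: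
  assumes "X \<subseteq> {1..n}" "X \<noteq> {}" "v \<in> undominated n X" "v + 1 \<in> undominated n X"
  obtains x where "x \<in> {1..n}" "int x \<notin> undominated n X" "touches (int x) (undominated n X)"
    "card (edges (hit (int x) (undominated n X))) + 1 = card (edges (undominated n X))"
    "v + 2 \<in> undominated n X \<Longrightarrow>
      int x + 1 \<in> undominated n X \<and> int x + 2 \<in> undominated n X \<and> int x + 3 \<in> undominated n X \<or>
      int x - 1 \<in> undominated n X \<and> int x - 2 \<in> undominated n X \<and> int x - 3 \<in> undominated n X"
proof -
  obtain y where "y \<in> X"
    using assms(2) by blast
  then have y: "int y \<notin> undominated n X" "y \<in> {1..n}"
    using assms(1) by (auto simp: undominated_def intro!: bexI[of _ y])
  have v: "v \<in> {1..int n}"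
    using assms(3) by (simp add: undominated_def)
  obtain x where x: "x \<notin> undominated n X" "min (int y) v \<le> x" "x \<le> max (int y) v"
    "touches x (undominated n X)"
    "card (edges (hit x (undominated n X))) + 1 = card (edges (undominated n X))"
    "v + 2 \<in> undominated n X \<Longrightarrow>
      x + 1 \<in> undominated n X \<and> x + 2 \<in> undominated n X \<and> x + 3 \<in> undominated n X \<or>
      x - 1 \<in> undominated n X \<and> x - 2 \<in> undominated n X \<and> x - 3 \<in> undominated n X"
    using ex_hit_next_to_run[OF finite_undominated wide_gaps_undominated[OF assms(1)] y(1) assms(3,4)]
    by metis
  have "x = int (nat x)" "nat x \<in> {1..n}"
    using x(2,3) y(2) v by auto
  with x that[of "nat x"] show ?thesis
    by metis
qed

text \<open>Dominator deletes at most four edges and Staller can delete just one, so a pair of moves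
  can be held to 5 edges.\<close>

lemma path_moves_ge:
  assumes "X \<subseteq> {1..n}" "X \<noteq> {}" "e = card (edges (undominated n X))"
  shows "(e + 4) div 5 + e div 5 \<le> path_moves n Dominator X"
    "(e + 3) div 5 + (e + 4) div 5 \<le> path_moves n Staller X"
proof -
  have "(e + 4) div 5 + e div 5 \<le> path_moves n Dominator X \<and>
    (e + 3) div 5 + (e + 4) div 5 \<le> path_moves n Staller X"
    using assms
  proof (induction e arbitrary: X rule: less_induct)
    case (less e)
    let ?U = "undominated n X"
    have e: "e = card (edges ?U)"
      by (rule less.prems(3))
    show ?case
    proof (cases "edges ?U = {}")
      case True
      then show ?thesis
        using e by simp
    next
      case False
      then obtain v where v: "v \<in> ?U" "v + 1 \<in> ?U"
        by auto
      obtain x where x: "x \<in> {1..n}" "touches (int x) ?U" "card (edges (hit (int x) ?U)) + 1 = e"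
        using ex_Staller_move[OF less.prems(1,2) v] e by metis
      have "((e - 1) + 4) div 5 + (e - 1) div 5 \<le> path_moves n Dominator (insert x X)"
        using less.IH[of "e - 1" "insert x X"] x less.prems(1) by (auto simp: undominated_insert)
      then have "((e - 1) + 4) div 5 + (e - 1) div 5 + 1 \<le> path_moves n Staller X"
        using less.prems(1) x by (intro Staller_ge[of X n x])
      moreover have "((e - 1) + 4) div 5 + (e - 1) div 5 + 1 = (e + 3) div 5 + (e + 4) div 5"
        using x(3) by auto
      ultimately have S: "(e + 3) div 5 + (e + 4) div 5 \<le> path_moves n Staller X"
        by simp
      \<comment> \<open>For \<open>e < 4\<close> truncation leaves the trivial bound 0 on the number
        of remaining edges.\<close>
      have "((e - 4) + 3) div 5 + ((e - 4) + 4) div 5 + 1 \<le> path_moves n Dominator X"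
      proof (rule Dominator_ge[OF less.prems(1) False])
        fix x assume x: "x \<in> {1..n}" "touches (int x) ?U"
        define e' where "e' = card (edges (undominated n (insert x X)))"
        have e': "e' < e" "e \<le> e' + 4"
          using edges_hit_less[OF _ x(2)] edges_le_hit[of ?U "int x"] e
          by (simp_all add: e'_def undominated_insert)
        have "((e - 4) + 3) div 5 + ((e - 4) + 4) div 5 \<le> (e' + 3) div 5 + (e' + 4) div 5"
          using e' by (intro add_mono div_le_mono) auto
        also have "\<dots> \<le> path_moves n Staller (insert x X)"
          using less.IH[OF e'(1) _ _ e'_def] x less.prems(1) by simp
        finally show "((e - 4) + 3) div 5 + ((e - 4) + 4) div 5 \<le> path_moves n Staller (insert x X)" .
      qed
      moreover have "(e + 4) div 5 \<le> ((e - 4) + 3) div 5 + 1" "e div 5 \<le> ((e - 4) + 4) div 5"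
        by linarith (intro div_le_mono, simp)
      ultimately show ?thesis
        using S by linarith
    qed
  qed
  then show "(e + 4) div 5 + e div 5 \<le> path_moves n Dominator X"
    "(e + 3) div 5 + (e + 4) div 5 \<le> path_moves n Staller X"
    by blast+
qed

text \<open>A run of exactly two vertices next to other runs acts as a spare move: it takes a full move of
  Dominator but decreases the number of edges by one only.\<close>
lemma path_moves_short_run_ge:
  assumes "X \<subseteq> {1..n}" "X \<noteq> {}" "short_run (undominated n X) a"
    "e = card (edges (undominated n X))" "2 \<le> e"
  shows "(e + 3) div 5 + (e + 4) div 5 \<le> path_moves n Dominator X"
    "(e + 2) div 5 + (e + 3) div 5 + 1 \<le> path_moves n Staller X"
proof -
  have "(e + 3) div 5 + (e + 4) div 5 \<le> path_moves n Dominator X \<and>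
    (e + 2) div 5 + (e + 3) div 5 + 1 \<le> path_moves n Staller X"
    using assms
  proof (induction e arbitrary: X a rule: less_induct)
    case (less e)
    let ?U = "undominated n X"
    have e: "e = card (edges ?U)"
      by (rule less.prems(4))
    have a: "a \<notin> ?U" "a + 1 \<in> ?U" "a + 2 \<in> ?U" "a + 3 \<notin> ?U"
      using less.prems(3) by (auto simp: short_run_def)
    have "edges ?U \<noteq> {}"
      using e less.prems(5) by auto
    have IH_D: "(e - 1 + 3) div 5 + (e - 1 + 4) div 5 \<le> path_moves n Dominator (insert x X)"
      if "x \<in> {1..n}" "card (edges (hit (int x) ?U)) + 1 = e" "3 \<le> e" "short_run (hit (int x) ?U) b" for x b
    proof -
      have "e - 1 = card (edges (undominated n (insert x X)))"
        using that(2) by (simp add: undominated_insert)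
      with that less.prems(1) show ?thesis
        by (intro less.IH[THEN conjunct1]) (auto simp: undominated_insert)
    qed
    \<comment> \<open>It suffices that a one-edge move leaves some pair, not necessarily the one at
      \<open>a\<close>. The condition \<open>3 \<le> e\<close> keeps two edges for the induction
      hypothesis.\<close>
    have S_if: "(e + 2) div 5 + (e + 3) div 5 + 1 \<le> path_moves n Staller X"
      if "x \<in> {1..n}" "touches (int x) ?U" "card (edges (hit (int x) ?U)) + 1 = e" "3 \<le> e"
        "short_run (hit (int x) ?U) b" for x b
    proof -
      have "(e - 1 + 3) div 5 + (e - 1 + 4) div 5 + 1 \<le> path_moves n Staller X"
        using less.prems(1) that IH_D by (intro Staller_ge[of X n x])
      with \<open>3 \<le> e\<close> show ?thesis
        by simp
    qed
    have S: "(e + 2) div 5 + (e + 3) div 5 + 1 \<le> path_moves n Staller X"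
    proof (cases "\<exists>v. v \<in> ?U \<and> v + 1 \<in> ?U \<and> v + 2 \<in> ?U")
      case True
      then obtain v where v: "v \<in> ?U" "v + 1 \<in> ?U" "v + 2 \<in> ?U"
        by blast
      obtain x where x: "x \<in> {1..n}" "int x \<notin> ?U" "touches (int x) ?U"
        "card (edges (hit (int x) ?U)) + 1 = e"
        "int x + 1 \<in> ?U \<and> int x + 2 \<in> ?U \<and> int x + 3 \<in> ?U \<or>
         int x - 1 \<in> ?U \<and> int x - 2 \<in> ?U \<and> int x - 3 \<in> ?U"
        using ex_Staller_move[OF less.prems(1,2) v(1,2)] v(3) e by metis
      \<comment> \<open>The chosen vertex borders a run of three or more, whereas by wide gaps
        \<open>a\<close> and \<open>a + 3\<close> border only the pair.\<close>
      have far: "int x < a \<or> a + 3 < int x"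
      proof (rule ccontr)
        assume "\<not> ?thesis"
        then have "int x = a \<or> int x = a + 1 \<or> int x = a + 2 \<or> int x = a + 3"
          by arith
        with a x(2) have "int x = a \<or> int x = a + 3"
          by metis
        moreover have "a - 1 \<notin> ?U" "a + 4 \<notin> ?U"
          using wide_gapsD[OF wide_gaps_undominated[OF less.prems(1)], of a]
            wide_gapsD[OF wide_gaps_undominated[OF less.prems(1)], of "a + 3"] a
          by (auto simp: add.commute)
        ultimately show False
          using x(5) a by (auto simp: add.commute)
      qed
      have "a + 1 \<noteq> v" "a + 1 \<noteq> v + 1"
        using a v by (auto simp: add.commute)
      then have "card {a + 1, v, v + 1} = 3"
        by simp
      moreover have "{a + 1, v, v + 1} \<subseteq> edges ?U"
        using a v by (auto simp: add.commute)
      ultimately have "3 \<le> e"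
        using card_mono[of "edges ?U" "{a + 1, v, v + 1}"] e by simp
      with x short_run_hit_far[OF less.prems(3) far] S_if show ?thesis
        by blast
    next
      \<comment> \<open>All runs are pairs: Staller removes one, and for \<open>3 \<le> e\<close>
        another pair takes over its role. For \<open>e = 2\<close> one edge remains and forces a
        second move.\<close>
      case no3: False
      obtain x where x: "a + 2 = int x" "x \<in> {1..n}"
        using a(3) by (rule undominated_nat)
      have hit: "touches (int x) ?U" "card (edges (hit (int x) ?U)) + 1 = e"
        using hit_short_run[OF finite_undominated less.prems(3)] e x(1) by simp_all
      have X': "insert x X \<subseteq> {1..n}" "insert x X \<noteq> {}"
        using x less.prems(1) by auto
      show ?thesis
      proof (cases "e = 2")
        case True
        then have "1 \<le> path_moves n Dominator (insert x X)"
          using path_moves_ge(1)[OF X' refl] hit(2) by (simp add: undominated_insert)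
        then have "1 + 1 \<le> path_moves n Staller X"
          using less.prems(1) x hit by (intro Staller_ge[of X n x]) auto
        with True show ?thesis
          by simp
      next
        case False
        with less.prems(5) have "3 \<le> e"
          by simp
        with hit(2) have "edges (hit (int x) ?U) \<noteq> {}"
          by auto
        then obtain v where "v \<in> edges (hit (int x) ?U)"
          by blast
        moreover have "\<nexists>v. v \<in> hit (int x) ?U \<and> v + 1 \<in> hit (int x) ?U \<and> v + 2 \<in> hit (int x) ?U"
          using no3 by auto
        ultimately have "short_run (hit (int x) ?U) (v - 1)"
          by (intro short_run_edge)
        with \<open>3 \<le> e\<close> x hit S_if show ?thesis
          by blast
      qed
    qed
    have "(e + 3) div 5 + (e + 4) div 5 - 1 + 1 \<le> path_moves n Dominator X"
    proof (rule Dominator_ge[OF less.prems(1) \<open>edges ?U \<noteq> {}\<close>])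
      fix x assume x: "x \<in> {1..n}" "touches (int x) ?U"
      define e' where "e' = card (edges (undominated n (insert x X)))"
      have e': "e' < e" "e \<le> e' + 4"
        using edges_hit_less[OF _ x(2)] edges_le_hit[of ?U "int x"] e
        by (simp_all add: e'_def undominated_insert)
      have X': "insert x X \<subseteq> {1..n}" "insert x X \<noteq> {}"
        using x less.prems(1) by auto
      have ge: "(e' + 3) div 5 + (e' + 4) div 5 \<le> path_moves n Staller (insert x X)"
        by (rule path_moves_ge(2)[OF X' e'_def])
      show "(e + 3) div 5 + (e + 4) div 5 - 1 \<le> path_moves n Staller (insert x X)"
      proof (cases "a \<le> int x \<and> int x \<le> a + 3")
        \<comment> \<open>Dominator spends the move on the pair and deletes one edge only, so
          \<open>path_moves_ge\<close> suffices.\<close>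
        case True
        then have "e \<le> e' + 1"
          using short_run_hit_near[OF finite_undominated wide_gaps_undominated[OF less.prems(1)] less.prems(3)] e
          by (simp add: e'_def undominated_insert)
        with ge show ?thesis
          using div_le_mono[of "e + 3" "e' + 4" 5] div_le_mono[of "e + 4" "e' + 5" 5] by linarith
      next
        case False
        then have short: "short_run (undominated n (insert x X)) a"
          using short_run_hit_far[OF less.prems(3)] by (simp add: undominated_insert not_le disj_commute)
        then have "a + 1 \<in> edges (undominated n (insert x X))"
          by (simp add: short_run_def add.commute)
        then have "edges (undominated n (insert x X)) \<noteq> {}"
          by blast
        then have "1 \<le> e'"
          by (simp add: e'_def Suc_le_eq card_gt_0_iff)
        show ?thesis
        proof (cases "2 \<le> e'")
          case True
          have "(e' + 2) div 5 + (e' + 3) div 5 + 1 \<le> path_moves n Staller (insert x X)"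
            using less.IH[OF e'(1) X' short e'_def True] by blast
          moreover have "(e + 3) div 5 \<le> (e' + 7) div 5" "(e + 4) div 5 \<le> (e' + 8) div 5"
            using e'(2) by (intro div_le_mono; simp)+
          moreover have "(e' + 7) div 5 = (e' + 2) div 5 + 1" "(e' + 8) div 5 = (e' + 3) div 5 + 1"
            by linarith+
          ultimately show ?thesis
            by linarith
        next
          \<comment> \<open>Only the edge of the pair is left, so \<open>e\<close> is at most 5 and
            a single further move is required.\<close>
          case False
          with \<open>1 \<le> e'\<close> have "e' = 1"
            by simp
          with e'(2) ge show ?thesis
            using div_le_mono[of "e + 3" 8 5] div_le_mono[of "e + 4" 9 5] by simp
        qed
      qed
    qed
    with S show ?case
      by linarith
  qed
  then show "(e + 3) div 5 + (e + 4) div 5 \<le> path_moves n Dominator X"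
    "(e + 2) div 5 + (e + 3) div 5 + 1 \<le> path_moves n Staller X"
    by blast+
qed


subsection \<open>The opening moves\<close>

lemma card_edges_path: "card (edges {1..int n}) = n - 1"
proof -
  have "edges {1..int n} = {1..int n - 1}"
    by auto
  then show ?thesis
    by simp
qed

lemma card_runs_path: "2 \<le> n \<Longrightarrow> card (runs {1..int n}) = 1"
proof -
  assume "2 \<le> n"
  then have "runs {1..int n} = {0}"
    by auto
  then show ?thesis
    by simp
qed

text \<open>The initial potential \<open>(n - 1) + 3\<close> gives the upper bound. The lower bounds
  need a selected vertex, so they are applied after the first move, when at least
  \<open>n - 5\<close> edges remain.\<close>

lemma path_moves_Dominator_start:
  assumes "2 \<le> n"
  shows "path_moves n Dominator {} = (n + 3) div 5 + (n - 1) div 5"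
proof (rule antisym)
  have "potential (undominated n {}) = n + 2"
    using assms by (simp add: potential_def undominated_empty card_edges_path card_runs_path)
  then show "path_moves n Dominator {} \<le> (n + 3) div 5 + (n - 1) div 5"
    using path_moves_le(1)[of "{}" n "n + 2"] by simp
  have "(n - 5 + 3) div 5 + (n - 5 + 4) div 5 + 1 \<le> path_moves n Dominator {}"
  proof (rule Dominator_ge)
    show "edges (undominated n {}) \<noteq> {}"
      using assms card_edges_path[of n] by (auto simp: undominated_empty simp del: in_edges)
    fix x assume x: "x \<in> {1..n}"
    define e where "e = card (edges (undominated n {x}))"
    have "n - 5 \<le> e"
      using edges_le_hit[of "{1..int n}" "int x"]
      by (simp add: e_def undominated_insert undominated_empty card_edges_path)
    then have "(n - 5 + 3) div 5 + (n - 5 + 4) div 5 \<le> (e + 3) div 5 + (e + 4) div 5"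
      by (intro add_mono div_le_mono) simp_all
    also have "\<dots> \<le> path_moves n Staller {x}"
      using x by (intro path_moves_ge(2)[OF _ _ e_def]) auto
    finally show "(n - 5 + 3) div 5 + (n - 5 + 4) div 5 \<le> path_moves n Staller {x}" .
  qed simp
  moreover have "(n + 3) div 5 \<le> (n - 5 + 3) div 5 + 1"
    by linarith
  moreover have "(n - 1) div 5 \<le> (n - 5 + 4) div 5"
    by (intro div_le_mono) simp
  ultimately show "(n + 3) div 5 + (n - 1) div 5 \<le> path_moves n Dominator {}"
    by linarith
qed

text \<open>Either Staller splits the path and the sharper bound for two runs applies, or at most
  one run remains and, for \<open>n \<ge> 3\<close>, at least two edges are lost.\<close>

lemma path_moves_Staller_start_le:
  assumes "2 \<le> n"
  shows "path_moves n Staller {} \<le> (2 * n + 2) div 5"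
proof -
  let ?U = "{1..int n}"
  have "path_moves n Staller {} \<le> (2 * n - 3) div 5 + 1"
  proof (rule Staller_le)
    fix x assume x: "x \<in> {1..n}" "touches (int x) (undominated n {})"
    define t where "t = potential (undominated n {x})"
    have U: "undominated n {x} = hit (int x) ?U"
      by (simp add: undominated_insert undominated_empty)
    have "potential ?U = n + 2"
      using assms by (simp add: potential_def card_edges_path card_runs_path)
    then have t: "t \<le> n + 1"
      using potential_hit_less[of ?U "int x"] x(2) by (simp add: t_def U undominated_empty)
    have X: "{x} \<subseteq> {1..n}"
      using x by simp
    show "path_moves n Dominator {x} \<le> (2 * n - 3) div 5"
    proof (cases "2 \<le> card (runs (undominated n {x}))")
      case True
      then have "path_moves n Dominator {x} \<le> (2 * t - 5) div 5"
        by (rule path_moves_two_runs_le(1)[OF X t_def])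
      also have "\<dots> \<le> (2 * n - 3) div 5"
        using t by (intro div_le_mono) simp
      finally show ?thesis .
    next
      case False
      show ?thesis
      proof (cases "n = 2")
        case True
        have "t \<le> 3"
          using t True by simp
        then have "path_moves n Dominator {x} \<le> 0"
          using path_moves_le(1)[OF X t_def] by simp
        then show ?thesis
          by simp
      next
        case n2: False
        \<comment> \<open>Even an end vertex deletes two edges once
          \<open>n \<ge> 3\<close>.\<close>
        have "card (edges (hit (int x) ?U)) + 2 \<le> n - 1"
          using card_edges_hit[of ?U "int x"] x(1) assms n2 card_edges_path[of n]
          by (auto simp: of_bool_def split: if_splits)
        then have "t \<le> n"
          using False by (simp add: t_def potential_def U)
        then have "path_moves n Dominator {x} \<le> (n + 1) div 5 + (n - 3) div 5"
          by (intro order_trans[OF path_moves_le(1)[OF X t_def]] add_mono div_le_mono) simp_all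
        also have "\<dots> \<le> (2 * n - 3) div 5"
        proof (cases "n < 4")
          case False
          then have "(n + 1) div 5 = (n - 4) div 5 + 1" "(n - 3) div 5 = (n - 4 + 1) div 5"
            "2 * (n - 4) div 5 + 1 = (2 * n - 3) div 5"
            by linarith+
          then show ?thesis
            using div5_add_div5_Suc_le[of "n - 4"] by linarith
        qed simp
        finally show ?thesis .
      qed
    qed
  qed simp
  also have "\<dots> = (2 * n + 2) div 5"
    using assms by linarith
  finally show ?thesis .
qed

text \<open>Staller opens at an end, except for \<open>n \<equiv> 2\<close> modulo 5, where playing the fourth vertex leaves
  the first two as a spare move.\<close>
lemma path_moves_Staller_start_ge:
  assumes "2 \<le> n"
  shows "(2 * n + 2) div 5 \<le> path_moves n Staller {}"
proof (cases "n mod 5 = 2 \<and> n \<noteq> 2")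
  case True
  define q where "q = n div 5"
  have n: "n = 5 * q + 2" "1 \<le> q"
    using True mult_div_mod_eq[of 5 n] by (auto simp: q_def)
  have U: "undominated n {4} = hit 4 {1..int n}"
    by (simp add: undominated_insert undominated_empty)
  have "7 \<le> int n"
    using n by simp
  \<comment> \<open>The move at 4 costs four edges, but the pair it leaves yields
    \<open>2 * q + 1\<close>; opening at an end, \<open>path_moves_ge\<close> would give only
    \<open>2 * q\<close>.\<close>
  then have "int (card (edges (undominated n {4}))) = int n - 5"
    using card_edges_hit[of "{1..int n}" 4] by (simp add: U card_edges_path)
  then have e: "card (edges (undominated n {4})) = n - 5"
    by linarith
  have "short_run (undominated n {4}) 0"
    unfolding U short_run_def using \<open>7 \<le> int n\<close> by simp
  then have "(n - 5 + 3) div 5 + (n - 5 + 4) div 5 \<le> path_moves n Dominator {4}"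
    using n e by (intro path_moves_short_run_ge(1)) simp_all
  moreover have "touches 4 (undominated n {})"
    using n unfolding touches_def undominated_empty by (intro bexI[of _ 4]) auto
  ultimately have "(n - 5 + 3) div 5 + (n - 5 + 4) div 5 + 1 \<le> path_moves n Staller {}"
    using n by (intro Staller_ge[of "{}" n 4]) simp_all
  moreover have "n - 5 + 3 = 5 * q" "n - 5 + 4 = 5 * q + 1" "2 * n + 2 = 5 * (2 * q + 1) + 1"
    using n by simp_all
  ultimately show ?thesis
    by simp
next
  case False
  have U: "undominated n {1} = hit 1 {1..int n}"
    by (simp add: undominated_insert undominated_empty)
  define e where "e = card (edges (undominated n {1}))"
  \<comment> \<open>An end vertex deletes two of the \<open>n - 1\<close> edges, or the only edge if
    \<open>n = 2\<close>.\<close>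
  have "int n - 3 \<le> int e"
    unfolding e_def U using card_edges_hit[of "{1..int n}" 1] assms
    by (simp add: card_edges_path of_bool_def split: if_splits)
  then have "n - 3 \<le> e"
    by linarith
  then have "(n - 3 + 4) div 5 + (n - 3) div 5 \<le> (e + 4) div 5 + e div 5"
    by (intro add_mono div_le_mono) simp_all
  also have "\<dots> \<le> path_moves n Dominator {1}"
    using assms by (intro path_moves_ge(1)[OF _ _ e_def]) simp_all
  finally have "(n - 3 + 4) div 5 + (n - 3) div 5 \<le> path_moves n Dominator {1}" .
  moreover have "touches 1 (undominated n {})"
    using assms unfolding touches_def undominated_empty by (intro bexI[of _ 1]) auto
  ultimately have "(n - 3 + 4) div 5 + (n - 3) div 5 + 1 \<le> path_moves n Staller {}"
    using assms by (intro Staller_ge[of "{}" n 1]) simp_all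
  moreover have "(2 * n + 2) div 5 \<le> (n - 3 + 4) div 5 + (n - 3) div 5 + 1"
  proof (cases "n = 2")
    case False
    define q where "q = n div 5"
    have "n = 5 * q + n mod 5" "n mod 5 < 5"
      by (simp_all add: q_def)
    then consider "n = 5 * q" | "n = 5 * q + 1" | "n = 5 * q + 3" | "n = 5 * q + 4"
      using False \<open>\<not> (n mod 5 = 2 \<and> n \<noteq> 2)\<close> by linarith
    then show ?thesis
    proof cases
      case 1
      with assms have "(2 * n + 2) div 5 = 2 * q" "(n - 3 + 4) div 5 = q" "(n - 3) div 5 + 1 = q"
        by linarith+
      then show ?thesis
        by linarith
    next
      case 2
      with assms have "(2 * n + 2) div 5 = 2 * q" "(n - 3 + 4) div 5 = q" "(n - 3) div 5 + 1 = q"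
        by linarith+
      then show ?thesis
        by linarith
    next
      case 3
      with assms have "(2 * n + 2) div 5 = 2 * q + 1" "(n - 3 + 4) div 5 = q" "(n - 3) div 5 = q"
        by linarith+
      then show ?thesis
        by linarith
    next
      case 4
      with assms have "(2 * n + 2) div 5 = 2 * q + 2" "(n - 3 + 4) div 5 = q + 1" "(n - 3) div 5 = q"
        by linarith+
      then show ?thesis
        by linarith
    qed
  qed simp
  ultimately show ?thesis
    by linarith
qed

theorem theorem2p5:
  fixes n :: nat
  assumes "n \<ge> 1"
  shows "int (\<iota>\<^sub>g (path_graph n)) =
           (if n mod 5 = 0 then \<lfloor>(2 * real n + 1) / 5\<rfloor> - 1 else \<lfloor>(2 * real n + 1) / 5\<rfloor>)
       \<and> int (\<iota>\<^sub>g' (path_graph n)) = \<lfloor>(2 * real n + 2) / 5\<rfloor>"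
proof -
  have floor: "\<lfloor>(2 * real n + real k) / 5\<rfloor> = int ((2 * n + k) div 5)" for k
    using floor_divide_of_nat_eq[of "2 * n + k" 5] by simp
  show ?thesis
  \<comment> \<open>A single vertex has no edge and no run, so the formulas for the opening do not
    cover it.\<close>
  proof (cases "n = 1")
    case True
    have "edges (undominated n {}) = {}"
      using True by (auto simp: undominated_empty)
    then have "path_moves n p {} = 0" for p
      by (intro path_moves_no_edges) simp_all
    with True show ?thesis
      by (simp add: game_isolation_number_def staller_game_isolation_number_def)
  next
    case False
    with assms have n: "2 \<le> n"
      by simp
    have S: "path_moves n Staller {} = (2 * n + 2) div 5"
      using path_moves_Staller_start_le[OF n] path_moves_Staller_start_ge[OF n] by simp
    define q where "q = n div 5"
    have "n = 5 * q + n mod 5" "n mod 5 < 5"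
      by (simp_all add: q_def)
    then consider "n = 5 * q" "n mod 5 = 0" | "n = 5 * q + 1" "n mod 5 = 1" | "n = 5 * q + 2" "n mod 5 = 2"
      | "n = 5 * q + 3" "n mod 5 = 3" | "n = 5 * q + 4" "n mod 5 = 4"
      by linarith
    \<comment> \<open>The exception at multiples of 5 arises because \<open>(n - 1) div 5\<close> is
      \<open>q - 1\<close> there and \<open>q\<close> for all other residues.\<close>
    then have "int ((n + 3) div 5 + (n - 1) div 5) =
        (if n mod 5 = 0 then int ((2 * n + 1) div 5) - 1 else int ((2 * n + 1) div 5))"
    proof cases
      case 1
      then have "(n + 3) div 5 = q" "(n - 1) div 5 + 1 = q" "(2 * n + 1) div 5 = 2 * q"
        using n by linarith+
      with 1 show ?thesis
        by simp
    next
      case 2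
      then have "(n + 3) div 5 = q" "(n - 1) div 5 = q" "(2 * n + 1) div 5 = 2 * q"
        using n by linarith+
      with 2 show ?thesis
        by simp
    next
      case 3
      then have "(n + 3) div 5 = q + 1" "(n - 1) div 5 = q" "(2 * n + 1) div 5 = 2 * q + 1"
        using n by linarith+
      with 3 show ?thesis
        by simp
    next
      case 4
      then have "(n + 3) div 5 = q + 1" "(n - 1) div 5 = q" "(2 * n + 1) div 5 = 2 * q + 1"
        using n by linarith+
      with 4 show ?thesis
        by simp
    next
      case 5
      then have "(n + 3) div 5 = q + 1" "(n - 1) div 5 = q" "(2 * n + 1) div 5 = 2 * q + 1"
        using n by linarith+
      with 5 show ?thesis
        by simp
    qed
    then show ?thesis
      using floor[of 1] floor[of 2] S path_moves_Dominator_start[OF n]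
      by (simp add: game_isolation_number_def staller_game_isolation_number_def)
  qed
qed

end
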